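(* Let $s\ge 0$ be an integer and let $\mathcal{D}_s(z)=\sum_{n\ge1} d_s(n)z^n$ be the ordinary generating function of the leaf-indicator sequence $d_s(n)$ of the infinite labelled tree $\mathcal{F}_s$. Then, as formal power series, \[ \mathcal{D}_s(z) = z\Big(1+z^{s+2^0}\big(1+z^{s+2^1}[1+z^{2^1-1}]\big(1+z^{s+2^2}[1+z^{2^2-1}]\big(1+z^{s+2^3}[1+z^{2^3-1}]\big(1+ \cdots \] where the infinite nested expression on the right means \[ z\Big(1+z^{s+1}\sum_{n\ge 0}\ \prod_{k=1}^{n} z^{s+2^k}\big(1+z^{2^k-1}\big)\Big). \]
   Context: For an integer $s \ge 0$, the infinite tree $\mathcal{F}_s$ is built as follows. It contains an initial single-node tree (one leaf); for each $h \ge 1$ a complete binary tree with $2^h-1$ nodes, called subtree $h$ (so the trees have sizes $1,1,3,7,15,\ldots$); and for each $h\ge 1$ a super-node $y_h$ consisting of $s$ ordinary nodes (no labelled nodes at all if $s=0$). The right child of $y_h$ is the root of subtree $h$; the left child of $y_h$ is $y_{h-1}$ if $h \ge 2$, and is the initial single-node tree if $h=1$. Labels $1,2,3,\ldots$ are given to the nodes in the following order: the initial single node, the $s$ nodes of $y_1$, the nodes of subtree $1$ in preorder, the $s$ nodes of $y_2$, the nodes of subtree $2$ in preorder, and so on. The leaves of $\mathcal{F}_s$ are the initial single node and the leaves of the subtrees $h\ge1$; all other nodes, including those in super-nodes, are internal. For $n\ge 1$, $d_s(n)=1$ if node $n$ is a leaf and $d_s(n)=0$ otherwise. *)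

theory Defs
  imports
    "HOL-Library.Tree"
    "HOL-Library.Stream"
    "HOL-Computational_Algebra.Formal_Power_Series"
begin

section \<open>The positions of the infinite tree\<close>

text \<open>
  A position is either the initial node, a super-node \<open>Super h\<close> (for \<open>y\<^sub>h\<close>), or a node
  \<open>Sub h p\<close> of subtree \<open>h\<close>, where \<open>p\<close> is its address, i.e. the path from the root of that
  subtree (\<^const>\<open>False\<close> for left, \<^const>\<open>True\<close> for right).  A super-node is a single
  position regardless of how many ordinary nodes it holds, so the shape of the tree does not
  depend on \<open>s\<close>, and super-nodes are present even if \<open>s = 0\<close>.
\<close>

datatype position = Initial | Super nat | Sub nat "bool list"

text \<open>The complete binary tree of height \<open>k\<close>, each node carrying its address prefixed by \<open>p\<close>.
  Throughout, \<^term>\<open>\<langle>\<rangle>\<close> is the empty tree, not a node.\<close>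

fun address_tree :: "nat \<Rightarrow> bool list \<Rightarrow> bool list tree" where
  "address_tree 0 p = \<langle>\<rangle>"
| "address_tree (Suc k) p =
     \<langle>address_tree k (p @ [False]), p, address_tree k (p @ [True])\<rangle>"

definition subtree :: "nat \<Rightarrow> position tree" where
  "subtree h = map_tree (Sub h) (address_tree h [])"

text \<open>\<open>spine h\<close> is the part of the infinite tree at and below \<open>y\<^sub>h\<close>; \<open>spine 0\<close> is the initial
  single-node tree.  The infinite tree is the union of the chain
  \<open>spine 0, spine 1, \<dots>\<close>, each of which is the left subtree of the next.\<close>

fun spine :: "nat \<Rightarrow> position tree" where
  "spine 0 = \<langle>\<langle>\<rangle>, Initial, \<langle>\<rangle>\<rangle>"
| "spine (Suc h) = \<langle>spine h, Super (Suc h), subtree (Suc h)\<rangle>"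

definition leaf_position :: "position \<Rightarrow> bool" where
  "leaf_position v \<longleftrightarrow> (\<exists>h. \<langle>\<langle>\<rangle>, v, \<langle>\<rangle>\<rangle> \<in> subtrees (spine h))"


section \<open>The ordinary nodes and their labels\<close>

text \<open>An ordinary node is a pair of a position and an index; super-nodes hold \<open>s\<close> ordinary nodes,
  all other positions exactly one.\<close>

type_synonym node = "position \<times> nat"

fun nodes_at :: "nat \<Rightarrow> position \<Rightarrow> node list" where
  "nodes_at s (Super h) = map (Pair (Super h)) [0..<s]"
| "nodes_at s v = [(v, 0)]"

definition block :: "nat \<Rightarrow> nat \<Rightarrow> node list" where
  "block s h = nodes_at s (Super h) @ concat (map (nodes_at s) (preorder (subtree h)))"

definition node_order :: "nat \<Rightarrow> node stream" where
  "node_order s = flat (nodes_at s Initial ## smap (block s) (fromN 1))"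

text \<open>Labels start at 1, stream indices at 0.\<close>

definition labelled_node :: "nat \<Rightarrow> nat \<Rightarrow> node" where
  "labelled_node s n = node_order s !! (n - 1)"

definition leaf_indicator :: "nat \<Rightarrow> nat \<Rightarrow> int" where
  "leaf_indicator s n = (if leaf_position (fst (labelled_node s n)) then 1 else 0)"

definition leaf_gf :: "nat \<Rightarrow> int fps" where
  "leaf_gf s = Abs_fps (\<lambda>n. if n \<ge> 1 then leaf_indicator s n else 0)"


section \<open>Sanity checks\<close>

lemma height_address_tree: "height (address_tree k p) = k"
  by (induction k arbitrary: p) auto

lemma complete_address_tree: "Tree.complete (address_tree k p)"
  by (induction k arbitrary: p) (auto simp: height_address_tree)

lemma complete_map_tree: "Tree.complete (map_tree f t) = Tree.complete t"
  by (induction t) auto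

lemma complete_subtree: "Tree.complete (subtree h)"
  by (simp add: subtree_def complete_map_tree complete_address_tree)

lemma size_subtree: "size (subtree h) = 2 ^ h - 1"
  using size_if_complete[OF complete_subtree, of h]
  by (simp add: subtree_def height_address_tree)

lemma subtrees_spine:
  "t \<in> subtrees (spine h) \<Longrightarrow>
     (\<exists>k. t = spine k) \<or> (\<exists>k\<ge>1. t \<in> subtrees (subtree k)) \<or> t = \<langle>\<rangle>"
proof (induction h)
  case 0
  then have "t = spine 0 \<or> t = \<langle>\<rangle>" by auto
  then show ?case by blast
next
  case (Suc h)
  from Suc.prems consider "t = spine (Suc h)" | "t \<in> subtrees (spine h)"
    | "t \<in> subtrees (subtree (Suc h))" by auto
  then show ?case
  proof cases
    case 1
    then show ?thesis by blast
  next
    case 2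
    then show ?thesis by (rule Suc.IH)
  next
    case 3
    moreover have "1 \<le> Suc h" by simp
    ultimately show ?thesis by blast
  qed
qed

text \<open>The leaves are the initial node and the leaves of the subtrees \<open>h \<ge> 1\<close>.\<close>

lemma leaf_position_iff:
  "leaf_position v \<longleftrightarrow> v = Initial \<or> (\<exists>h\<ge>1. \<langle>\<langle>\<rangle>, v, \<langle>\<rangle>\<rangle> \<in> subtrees (subtree h))"
proof
  assume "leaf_position v"
  then obtain h where h: "\<langle>\<langle>\<rangle>, v, \<langle>\<rangle>\<rangle> \<in> subtrees (spine h)"
    by (auto simp: leaf_position_def)
  have "v = Initial" if "\<langle>\<langle>\<rangle>, v, \<langle>\<rangle>\<rangle> = spine k" for k
  proof (cases k)
    case 0
    with that show ?thesis by simp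
  next
    case (Suc j)
    with that have "spine j = \<langle>\<rangle>" by simp
    then show ?thesis by (cases j) auto
  qed
  with subtrees_spine[OF h] show "v = Initial \<or> (\<exists>h\<ge>1. \<langle>\<langle>\<rangle>, v, \<langle>\<rangle>\<rangle> \<in> subtrees (subtree h))"
    by auto
next
  assume "v = Initial \<or> (\<exists>h\<ge>1. \<langle>\<langle>\<rangle>, v, \<langle>\<rangle>\<rangle> \<in> subtrees (subtree h))"
  then show "leaf_position v"
  proof
    assume "v = Initial"
    then show ?thesis unfolding leaf_position_def by (intro exI[of _ 0]) simp
  next
    assume "\<exists>h\<ge>1. \<langle>\<langle>\<rangle>, v, \<langle>\<rangle>\<rangle> \<in> subtrees (subtree h)"
    then obtain j where "\<langle>\<langle>\<rangle>, v, \<langle>\<rangle>\<rangle> \<in> subtrees (subtree (Suc j))"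
      by (metis Suc_le_D One_nat_def)
    then show ?thesis unfolding leaf_position_def by (intro exI[of _ "Suc j"]) simp
  qed
qed

end

theory Submission
  imports Defs
begin

text \<open>
  Let \<open>G\<^sub>n\<close> be the generating function of the leaf indicator along the labelling, started at the
  root of subtree \<open>n + 1\<close>.  In the complete tree of height \<open>n + 1\<close>, prefixing a root shifts the
  positions by one and the second copy of a child is delayed by the size of the first, so its
  leaves contribute \<open>z\<^sup>n \<Prod>\<^sub>k\<^sub>\<le>\<^sub>n (1 + z^(2^k - 1))\<close>.  Passing to the next subtree costs
  \<open>2^(n+1) - 1 + s\<close> positions, which gives a linear recursion for \<open>G\<^sub>n\<close>; unrolling it from \<open>G\<^sub>0\<close>
  yields the partial sums of the series plus a remainder of ever higher order.
\<close>

text \<open>Exponents are positions counted from 0; the shift to labels counted from 1 is made once,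
  in \<open>leaf_gf_eq\<close>.\<close>

definition list_gf :: "('a \<Rightarrow> bool) \<Rightarrow> 'a list \<Rightarrow> int fps" where
  "list_gf P xs = Abs_fps (\<lambda>n. of_bool (n < length xs \<and> P (xs ! n)))"

definition stream_gf :: "('a \<Rightarrow> bool) \<Rightarrow> 'a stream \<Rightarrow> int fps" where
  "stream_gf P w = Abs_fps (\<lambda>n. of_bool (P (w !! n)))"

lemma list_gf_Nil: "list_gf P [] = 0"
  by (simp add: list_gf_def fps_eq_iff)

lemma list_gf_append:
  "list_gf P (xs @ ys) = list_gf P xs + fps_X ^ length xs * list_gf P ys"
  by (auto simp: list_gf_def fps_eq_iff fps_X_power_mult_nth nth_append)

lemma list_gf_Cons: "list_gf P (x # xs) = of_bool (P x) + fps_X * list_gf P xs"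
  using list_gf_append[of P "[x]" xs] by (auto simp: list_gf_def fps_eq_iff)

lemma list_gf_map: "list_gf P (map f xs) = list_gf (\<lambda>x. P (f x)) xs"
  by (auto simp: list_gf_def fps_eq_iff)

lemma list_gf_cong:
  "(\<And>x. x \<in> set xs \<Longrightarrow> P x = Q x) \<Longrightarrow> list_gf P xs = list_gf Q xs"
  by (auto simp: list_gf_def fps_eq_iff)

lemma list_gf_eq_0: "(\<And>x. x \<in> set xs \<Longrightarrow> \<not> P x) \<Longrightarrow> list_gf P xs = 0"
  by (auto simp: list_gf_def fps_eq_iff)

lemma stream_gf_shift:
  "stream_gf P (xs @- w) = list_gf P xs + fps_X ^ length xs * stream_gf P w"
  by (auto simp: list_gf_def stream_gf_def fps_eq_iff fps_X_power_mult_nth shift_snth)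

lemma length_le_address_tree:
  "q \<in> set_tree (address_tree k p) \<Longrightarrow> length p \<le> length q"
  by (induction k arbitrary: p) fastforce+

text \<open>All leaves of a complete tree lie on its lowest level, and each level adds one bit to
  the address, so being a leaf becomes a condition on address length alone.\<close>

lemma leaf_address_tree:
  "\<langle>\<langle>\<rangle>, q, \<langle>\<rangle>\<rangle> \<in> subtrees (address_tree k p) \<longleftrightarrow>
     q \<in> set_tree (address_tree k p) \<and> length q + 1 = length p + k"
proof (induction k arbitrary: p)
  case 0
  then show ?case by simp
next
  case (Suc k)
  have empty: "address_tree k r = \<langle>\<rangle> \<longleftrightarrow> k = 0" for r
    by (cases k) auto
  have "length q \<noteq> length p" if "q \<in> set_tree (address_tree k (p @ [b]))" for b
    using length_le_address_tree[OF that] by simp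
  then show ?case
    using Suc.IH[of "p @ [False]"] Suc.IH[of "p @ [True]"]
    by (cases "k = 0") (auto simp: empty eq_commute[of "\<langle>\<rangle>"])
qed

lemma size_address_tree: "size (address_tree k p) = 2 ^ k - 1"
  using size_if_complete[OF complete_address_tree, of k p] by (simp add: height_address_tree)

text \<open>The predicate is phrased by length because it then agrees with the one for either child
  prefix \<open>p @ [b]\<close> one level down, so both children contribute the same series.\<close>

lemma list_gf_address_tree:
  "list_gf (\<lambda>q. length q = length p + k) (preorder (address_tree (Suc k) p)) =
     fps_X ^ k * (\<Prod>i=1..k. 1 + fps_X ^ (2 ^ i - 1))"
proof (induction k arbitrary: p)
  case 0
  then show ?case by (simp add: list_gf_Cons list_gf_Nil)
next
  case (Suc k)
  let ?A = "fps_X ^ k * (\<Prod>i=1..k. 1 + fps_X ^ (2 ^ i - 1)) :: int fps"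
  have IH: "list_gf (\<lambda>q. length q = length p + Suc k) (preorder (address_tree (Suc k) (p @ [b]))) = ?A"
    for b using Suc.IH[of "p @ [b]"] by simp
  have "list_gf (\<lambda>q. length q = length p + Suc k) (preorder (address_tree (Suc (Suc k)) p)) =
      fps_X * (?A + fps_X ^ (2 ^ Suc k - 1) * ?A)"
    unfolding address_tree.simps(2)[of "Suc k"] preorder.simps(2) list_gf_Cons list_gf_append IH
      length_preorder size_address_tree by simp
  also have "\<dots> = fps_X ^ Suc k * (\<Prod>i=1..Suc k. 1 + fps_X ^ (2 ^ i - 1))"
    by (simp add: algebra_simps)
  finally show ?case .
qed

lemma subtrees_map_tree: "subtrees (map_tree f t) = map_tree f ` subtrees t"
  by (induction t) auto

lemma leaf_in_subtree_iff:
  "\<langle>\<langle>\<rangle>, v, \<langle>\<rangle>\<rangle> \<in> subtrees (subtree h) \<longleftrightarrow>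
     (\<exists>q. v = Sub h q \<and> q \<in> set_tree (address_tree h []) \<and> length q + 1 = h)"
proof -
  have "\<langle>\<langle>\<rangle>, v, \<langle>\<rangle>\<rangle> = map_tree (Sub h) t \<longleftrightarrow> (\<exists>q. v = Sub h q \<and> t = \<langle>\<langle>\<rangle>, q, \<langle>\<rangle>\<rangle>)" for t
    by (cases t) (auto simp: eq_commute[of "\<langle>\<rangle>"])
  then show ?thesis
    using leaf_address_tree[of _ h "[]"]
    by (auto simp: subtree_def subtrees_map_tree image_iff)
qed

lemma leaf_position_Super: "\<not> leaf_position (Super h)"
  by (simp add: leaf_position_iff leaf_in_subtree_iff)

lemma leaf_position_Sub:
  assumes "q \<in> set_tree (address_tree h [])"
  shows "leaf_position (Sub h q) \<longleftrightarrow> length q + 1 = h"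
  using assms by (auto simp: leaf_position_iff leaf_in_subtree_iff)

definition subtree_nodes :: "nat \<Rightarrow> node list" where
  "subtree_nodes h = map (\<lambda>q. (Sub h q, 0)) (preorder (address_tree h []))"

lemma block_eq: "block s h = map (Pair (Super h)) [0..<s] @ subtree_nodes h"
  by (simp add: block_def subtree_nodes_def subtree_def preorder_map comp_def)

text \<open>If \<open>s = 0\<close>, the super-node part of a block is empty; this still keeps the
  block nonempty, as unfolding \<open>flat\<close> requires.\<close>

lemma subtree_nodes_ne: "subtree_nodes (Suc n) \<noteq> []"
  by (simp add: subtree_nodes_def)

lemma length_subtree_nodes: "length (subtree_nodes h) = 2 ^ h - 1"
  by (simp add: subtree_nodes_def size_address_tree)

abbreviation leaf_node :: "node \<Rightarrow> bool" where
  "leaf_node x \<equiv> leaf_position (fst x)"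

lemma list_gf_subtree_nodes:
  "list_gf leaf_node (subtree_nodes (Suc n)) =
     fps_X ^ n * (\<Prod>i=1..n. 1 + fps_X ^ (2 ^ i - 1))"
proof -
  have "list_gf leaf_node (subtree_nodes (Suc n)) =
      list_gf (\<lambda>q. length q = length ([] :: bool list) + n) (preorder (address_tree (Suc n) []))"
    unfolding subtree_nodes_def list_gf_map
    by (intro list_gf_cong) (simp only: set_preorder fst_conv leaf_position_Sub, simp)
  then show ?thesis by (simp only: list_gf_address_tree)
qed

definition blocks_from :: "nat \<Rightarrow> nat \<Rightarrow> node stream" where
  "blocks_from s h = flat (smap (block s) (fromN h))"

lemma blocks_from_Suc:
  "blocks_from s (Suc n) = map (Pair (Super (Suc n))) [0..<s] @-
     subtree_nodes (Suc n) @- blocks_from s (Suc (Suc n))"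
proof -
  have "blocks_from s (Suc n) = block s (Suc n) @- blocks_from s (Suc (Suc n))"
    unfolding blocks_from_def
    by (subst flat_unfold) (simp_all add: block_eq subtree_nodes_ne)
  then show ?thesis by (simp add: block_eq)
qed

text \<open>The series \<open>G\<^sub>n\<close> of the sketch.\<close>

definition tail_gf :: "nat \<Rightarrow> nat \<Rightarrow> int fps" where
  "tail_gf s n = stream_gf leaf_node (subtree_nodes (Suc n) @- blocks_from s (Suc (Suc n)))"

text \<open>Super-nodes contain no leaves, so their \<open>s\<close> nodes only delay what
  follows.\<close>

lemma stream_gf_blocks_from:
  "stream_gf leaf_node (blocks_from s (Suc n)) = fps_X ^ s * tail_gf s n"
proof -
  have "list_gf leaf_node (map (Pair (Super (Suc n))) [0..<s]) = 0"
    by (rule list_gf_eq_0) (auto simp: leaf_position_Super)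
  then show ?thesis
    \<comment> \<open>The pattern \<open>map _ _\<close> splits off the super-node alone and leaves
      the rest in the shape of \<open>tail_gf\<close>.\<close>
    by (simp only: blocks_from_Suc[of s n] stream_gf_shift[of _ "map _ _"] tail_gf_def) simp
qed

lemma tail_gf_rec:
  "tail_gf s n = fps_X ^ n * (\<Prod>i=1..n. 1 + fps_X ^ (2 ^ i - 1))
     + fps_X ^ (s + 2 ^ Suc n - 1) * tail_gf s (Suc n)"
proof -
  \<comment> \<open>The nodes of subtree \<open>Suc n\<close> come first, then those of the next
    super-node; \<open>2 ^ Suc n\<close> is positive, so nothing is truncated.\<close>
  have "s + 2 ^ Suc n - 1 = (2 ^ Suc n - 1) + s"
    by simp
  then show ?thesis
    unfolding tail_gf_def[of s n] stream_gf_shift list_gf_subtree_nodes stream_gf_blocks_from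
      length_subtree_nodes by (simp only: power_add mult.assoc)
qed

text \<open>The summand \<open>1\<close> is the initial leaf; \<open>s + 1\<close> counts that node
  and the nodes of the first super-node.\<close>

lemma leaf_gf_eq: "leaf_gf s = fps_X * (1 + fps_X ^ (s + 1) * tail_gf s 0)"
proof -
  have order: "node_order s = [(Initial, 0)] @- blocks_from s (Suc 0)"
    by (simp add: node_order_def blocks_from_def)
  have "leaf_gf s = fps_X * stream_gf leaf_node (node_order s)"
    by (auto simp: fps_eq_iff leaf_gf_def stream_gf_def leaf_indicator_def labelled_node_def)
  also have "stream_gf leaf_node (node_order s) = 1 + fps_X ^ (s + 1) * tail_gf s 0"
    unfolding order stream_gf_shift stream_gf_blocks_from
    by (simp add: list_gf_Cons list_gf_Nil leaf_position_iff mult.assoc)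
  finally show ?thesis .
qed

theorem theorem2p12:
  fixes s :: nat
  shows "summable (\<lambda>n. \<Prod>k=1..n.
            fps_X ^ (s + 2 ^ k) * (1 + fps_X ^ (2 ^ k - 1)) :: int fps)
       \<and> leaf_gf s = fps_X * (1 + fps_X ^ (s + 1) *
            (\<Sum>n. \<Prod>k=1..n. fps_X ^ (s + 2 ^ k) * (1 + fps_X ^ (2 ^ k - 1))))"
proof -
  define A :: "nat \<Rightarrow> int fps"
    where "A n = (\<Prod>k=1..n. fps_X ^ (s + 2 ^ k) * (1 + fps_X ^ (2 ^ k - 1)))" for n
  \<comment> \<open>The total delay after unrolling \<open>tail_gf_rec\<close> \<open>n\<close>
    times from \<open>tail_gf s 0\<close>.\<close>
  define e where "e n = (\<Sum>k=1..n. s + 2 ^ k - 1 :: nat)" for n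
  \<comment> \<open>Each of the \<open>n\<close> factors gives up one \<open>fps_X\<close>; together
    these form the \<open>fps_X ^ n\<close> that is the depth of the leaves in subtree
    \<open>n + 1\<close>.\<close>
  have A_eq: "A n = fps_X ^ e n * (fps_X ^ n * (\<Prod>k=1..n. 1 + fps_X ^ (2 ^ k - 1)))" for n
  proof (induction n)
    case 0
    then show ?case by (simp add: A_def e_def)
  next
    case (Suc n)
    have "s + 2 ^ Suc n = (s + 2 ^ Suc n - 1) + 1"
      by simp
    then have "(fps_X :: int fps) ^ (s + 2 ^ Suc n) = fps_X ^ (s + 2 ^ Suc n - 1) * fps_X"
      by (metis power_add power_one_right)
    then have "A (Suc n) = A n * (fps_X ^ (s + 2 ^ Suc n - 1) * fps_X) * (1 + fps_X ^ (2 ^ Suc n - 1))"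
      by (simp add: A_def mult.assoc)
    moreover have "e (Suc n) = e n + (s + 2 ^ Suc n - 1)"
      by (simp add: e_def)
    ultimately show ?case
      unfolding Suc.IH by (simp add: power_add mult_ac)
  qed
  have partial: "tail_gf s 0 = (\<Sum>i<n. A i) + fps_X ^ e n * tail_gf s n" for n
  proof (induction n)
    case 0
    then show ?case by (simp add: e_def)
  next
    case (Suc n)
    have "fps_X ^ e n * tail_gf s n = A n + fps_X ^ e (Suc n) * tail_gf s (Suc n)"
      by (subst tail_gf_rec) (simp add: A_eq e_def power_add ring_distribs mult.assoc)
    with Suc.IH show ?case by simp
  qed
  have e_ge: "n \<le> e n" for n
  proof -
    \<comment> \<open>For \<open>s = 0\<close> this relies on the sum starting at
      \<open>k = 1\<close>.\<close>
    have "1 \<le> s + 2 ^ k - 1" if "1 \<le> k" for k :: nat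
      using power_increasing[OF that, of "2 :: nat"] by simp
    then have "(\<Sum>k=1..n. 1) \<le> e n"
      unfolding e_def by (intro sum_mono) simp
    then show ?thesis by simp
  qed
  have "A sums tail_gf s 0"
    unfolding sums_def
  \<comment> \<open>It suffices that each coefficient is eventually constant: the remainder does not
    reach coefficient \<open>m\<close> once \<open>m < n\<close>, since
    \<open>n \<le> e n\<close>.\<close>
  proof (rule tendsto_fpsI)
    fix m
    have "fps_nth (\<Sum>i<n. A i) m = fps_nth (tail_gf s 0) m" if "m < n" for n
    proof -
      have "fps_nth (fps_X ^ e n * tail_gf s n) m = 0"
        using that e_ge[of n] by (simp add: fps_X_power_mult_nth)
      then show ?thesis
        by (subst partial[of n]) simp
    qed
    then show "\<forall>\<^sub>F n in sequentially. fps_nth (\<Sum>i<n. A i) m = fps_nth (tail_gf s 0) m"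
      by (rule eventually_mono[OF eventually_gt_at_top])
  qed
  then show ?thesis
    unfolding leaf_gf_eq A_def by (simp add: sums_iff)
qed

end
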